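(* Let $X$ be a Banach space. The function $\mathrm{blr}:\mathcal{C}(X)\to\mathbb{R}$ is $1$-Lipschitz. In particular, in case $X$ is separable, the family $\mathcal{H}^+(X)$ of all Haar positive closed, convex and bounded subsets of $X$ is open in $\mathcal{C}(X)$. Equivalently, a convergent sequence $(C_n)_{n=1}^\infty\subset\mathcal{C}(X)$ of Haar null sets has a Haar null limit.
   Context: All Banach spaces are real; $B_X$ is the closed unit ball of $X$ and $\mathrm{cl}$ denotes norm closure. $\mathcal{C}(X)$ is the space of all nonempty, closed, convex and bounded subsets of $X$, endowed with the Hausdorff distance $$d_{\mathrm H}(C,D)=\inf\{\varepsilon>0 : C\subseteq\mathrm{cl}(D+\varepsilon B_X)\text{ and }D\subseteq\mathrm{cl}(C+\varepsilon B_X)\};$$ the Lipschitz property, openness and convergence all refer to this metric. For $\rho>0$ and a nonempty, closed, convex set $C\subseteq X$, the $\rho$-loose radius $\mathrm{lr}(C,\rho)$ is the supremum of all $r\geq 0$ with the property that, for every finite set $F=\{x_1,\dots,x_n\}\subseteq rB_X$ and every $\varepsilon>0$, there are a finite set $G=\{y_1,\dots,y_n\}\subseteq X$ and $z\in\rho B_X$ such that $\|x_j-y_j\|<\varepsilon$ for every $j\in\{1,\dots,n\}$ and $z+G\subseteq C$. For $C\in\mathcal{C}(X)$, the bounded loose radius is $\mathrm{blr}(C)=\sup_{\rho>0}\mathrm{lr}(C,\rho)$. A Borel set $E$ in a separable Banach space $X$ is Haar null if there is a Borel probability measure $\mu$ on $X$ such that $\mu(x+E)=0$ for every $x\in X$;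 it is Haar positive if it is not Haar null. *)

theory Defs
  imports "HOL-Probability.Probability"
begin

definition cbc_sets :: "'a::real_normed_vector set set" where
  "cbc_sets = {C. C \<noteq> {} \<and> closed C \<and> convex C \<and> bounded C}"

definition enlargement :: "'a::real_normed_vector set \<Rightarrow> real \<Rightarrow> 'a set" where
  "enlargement D \<epsilon> = {d + \<epsilon> *\<^sub>R u | d u. d \<in> D \<and> u \<in> cball 0 1}"

definition hausdorff_dist :: "'a::real_normed_vector set \<Rightarrow> 'a set \<Rightarrow> real" where
  "hausdorff_dist C D =
     Inf {\<epsilon>. \<epsilon> > 0 \<and> C \<subseteq> closure (enlargement D \<epsilon>) \<and> D \<subseteq> closure (enlargement C \<epsilon>)}"

text \<open>The value outside the carrier is irrelevant, but the library requires a metric to be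
  symmetric and nonnegative everywhere, hence the case distinction. That this is indeed a metric
  with carrier \<open>cbc_sets\<close>, given there by \<open>hausdorff_dist\<close>, is shown below.\<close>

definition hausdorff_metric :: "'a::real_normed_vector set metric" where
  "hausdorff_metric =
     metric (cbc_sets, \<lambda>C D. if C \<in> cbc_sets \<and> D \<in> cbc_sets then hausdorff_dist C D else 0)"

definition loose_admissible :: "'a::real_normed_vector set \<Rightarrow> real \<Rightarrow> real \<Rightarrow> bool" where
  "loose_admissible C \<rho> r \<longleftrightarrow>
     (\<forall>(n::nat) (x::nat \<Rightarrow> 'a) \<epsilon>. (\<forall>j\<in>{1..n}. x j \<in> cball 0 r) \<and> \<epsilon> > 0 \<longrightarrow>
        (\<exists>(y::nat \<Rightarrow> 'a). \<exists>z\<in>cball 0 \<rho>.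
           (\<forall>j\<in>{1..n}. norm (x j - y j) < \<epsilon>) \<and> (\<forall>j\<in>{1..n}. z + y j \<in> C)))"

text \<open>The supremum is taken in the extended half-line: it is infinite for example for \<open>C = UNIV\<close>,
  and it is 0 if no \<open>r \<ge> 0\<close> is admissible, that is, if the distance of \<open>C\<close> to the origin
  exceeds \<open>\<rho>\<close>.\<close>

definition loose_radius :: "'a::real_normed_vector set \<Rightarrow> real \<Rightarrow> ennreal" where
  "loose_radius C \<rho> = (SUP r\<in>{r. r \<ge> 0 \<and> loose_admissible C \<rho> r}. ennreal r)"

definition bounded_loose_radius :: "'a::real_normed_vector set \<Rightarrow> ennreal" where
  "bounded_loose_radius C = (SUP \<rho>\<in>{0<..}. loose_radius C \<rho>)"

definition haar_null :: "'a::real_normed_vector set \<Rightarrow> bool" where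
  "haar_null E \<longleftrightarrow> E \<in> sets borel \<and>
     (\<exists>\<mu>. prob_space \<mu> \<and> sets \<mu> = sets borel \<and> (\<forall>x. emeasure \<mu> ((\<lambda>e. x + e) ` E) = 0))"

definition haar_positive :: "'a::real_normed_vector set \<Rightarrow> bool" where
  "haar_positive E \<longleftrightarrow> E \<in> sets borel \<and> \<not> haar_null E"

definition haar_positive_cbc :: "'a::real_normed_vector set set" where
  "haar_positive_cbc = {C \<in> cbc_sets. haar_positive C}"

lemma enlargementI: "d \<in> D \<Longrightarrow> dist x d \<le> \<epsilon> \<Longrightarrow> \<epsilon> > 0 \<Longrightarrow> x \<in> enlargement D \<epsilon>"
  unfolding enlargement_def
  by (rule CollectI, rule exI[of _ d], rule exI[of _ "(x - d) /\<^sub>R \<epsilon>"])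
     (simp add: dist_norm divide_simps del: scaleR_right_diff_distrib)

lemma closure_enlargementD:
  assumes "x \<in> closure (enlargement D \<epsilon>)" "\<epsilon> > 0" "\<eta> > \<epsilon>"
  shows "\<exists>d\<in>D. dist x d < \<eta>"
proof -
  from assms(1,3) obtain y where y: "y \<in> enlargement D \<epsilon>" "dist y x < \<eta> - \<epsilon>"
    using closure_approachable[of x] by (metis diff_gt_0_iff_gt)
  then obtain d u where du: "d \<in> D" "norm u \<le> 1" "y = d + \<epsilon> *\<^sub>R u"
    by (auto simp: enlargement_def)
  have "\<epsilon> * norm u \<le> \<epsilon>" using du(2) assms(2) by (simp add: mult_left_le)
  then have "dist y d \<le> \<epsilon>" using du(3) assms(2) by (simp add: dist_norm)
  moreover have "dist x d \<le> dist y x + dist y d" by (rule dist_triangle3)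
  ultimately have "dist x d < \<eta>" using y(2) by linarith
  with du(1) show ?thesis by blast
qed

context
  fixes C D :: "'a::real_normed_vector set"
  assumes C: "C \<in> cbc_sets" and D: "D \<in> cbc_sets"
begin

lemma hausdorff_dist_nonempty:
  "{\<epsilon>. \<epsilon> > 0 \<and> C \<subseteq> closure (enlargement D \<epsilon>) \<and> D \<subseteq> closure (enlargement C \<epsilon>)} \<noteq> {}"
proof -
  obtain c d where cd: "c \<in> C" "d \<in> D" using C D by (auto simp: cbc_sets_def)
  have "bounded (C \<union> D)" using C D by (auto simp: cbc_sets_def)
  then obtain M where M: "\<And>x y. x \<in> C \<union> D \<Longrightarrow> y \<in> C \<union> D \<Longrightarrow> dist x y \<le> M"
    using bounded_two_points[of "C \<union> D"] by blast
  let ?e = "max M 1"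
  have "x \<in> enlargement D ?e" if "x \<in> C" for x
    using cd(2) M[of x d] that by (intro enlargementI) auto
  moreover have "x \<in> enlargement C ?e" if "x \<in> D" for x
    using cd(1) M[of x c] that by (intro enlargementI) auto
  ultimately have "C \<subseteq> closure (enlargement D ?e)" "D \<subseteq> closure (enlargement C ?e)"
    using closure_subset by blast+
  then show ?thesis by (auto intro!: exI[of _ ?e])
qed

lemma hausdorff_dist_nonneg: "0 \<le> hausdorff_dist C D"
  unfolding hausdorff_dist_def using hausdorff_dist_nonempty by (intro cInf_greatest) auto

lemma hausdorff_dist_less:
  assumes "hausdorff_dist C D < e"
  shows "\<forall>x\<in>C. \<exists>d\<in>D. dist x d < e" "\<forall>x\<in>D. \<exists>c\<in>C. dist x c < e"
proof -
  obtain e' where "e' > 0" "e' < e"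
      "C \<subseteq> closure (enlargement D e')" "D \<subseteq> closure (enlargement C e')"
    using cInf_lessD[OF hausdorff_dist_nonempty] assms unfolding hausdorff_dist_def by blast
  then show "\<forall>x\<in>C. \<exists>d\<in>D. dist x d < e" "\<forall>x\<in>D. \<exists>c\<in>C. dist x c < e"
    using closure_enlargementD by blast+
qed

lemma hausdorff_dist_le:
  assumes "e > 0" "\<And>x. x \<in> C \<Longrightarrow> \<exists>d\<in>D. dist x d < e" "\<And>x. x \<in> D \<Longrightarrow> \<exists>c\<in>C. dist x c < e"
  shows "hausdorff_dist C D \<le> e"
proof -
  have "C \<subseteq> enlargement D e" "D \<subseteq> enlargement C e"
    using assms enlargementI less_imp_le by blast+
  then have "C \<subseteq> closure (enlargement D e)" "D \<subseteq> closure (enlargement C e)"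
    using closure_subset by blast+
  then show ?thesis
    unfolding hausdorff_dist_def using assms(1)
    by (intro cInf_lower bdd_belowI[of _ 0]) auto
qed

end

lemma hausdorff_dist_commute: "hausdorff_dist C D = hausdorff_dist D C"
  unfolding hausdorff_dist_def by (rule arg_cong[of _ _ Inf]) auto

lemma hausdorff_dist_zero_subset:
  assumes "C \<in> cbc_sets" "D \<in> cbc_sets" "hausdorff_dist C D = 0"
  shows "C \<subseteq> D"
proof
  fix x assume "x \<in> C"
  then have "\<exists>d\<in>D. dist d x < e" if "e > 0" for e
    using hausdorff_dist_less(1)[OF assms(1,2), of e] assms(3) \<open>x \<in> C\<close> that
    by (metis dist_commute)
  then have "x \<in> closure D" by (simp add: closure_approachable)
  then show "x \<in> D" using assms(2) by (simp add: cbc_sets_def)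
qed

lemma hausdorff_dist_zero_iff:
  assumes "C \<in> cbc_sets" "D \<in> cbc_sets"
  shows "hausdorff_dist C D = 0 \<longleftrightarrow> C = D"
proof
  assume "hausdorff_dist C D = 0"
  then show "C = D"
    using hausdorff_dist_zero_subset assms hausdorff_dist_commute[of C D] by (metis subset_antisym)
next
  assume "C = D"
  moreover have "hausdorff_dist C C \<le> e" if "e > 0" for e
    using assms(1) that by (intro hausdorff_dist_le) (auto intro!: bexI)
  ultimately show "hausdorff_dist C D = 0"
    using hausdorff_dist_nonneg[OF assms] by (metis dense_ge dual_order.antisym)
qed

lemma hausdorff_dist_triangle:
  assumes C: "C \<in> cbc_sets" and D: "D \<in> cbc_sets" and E: "E \<in> cbc_sets"
  shows "hausdorff_dist C E \<le> hausdorff_dist C D + hausdorff_dist D E"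
proof (rule field_le_epsilon)
  fix e :: real assume e: "e > 0"
  define a where "a = hausdorff_dist C D + e / 2"
  define b where "b = hausdorff_dist D E + e / 2"
  have a: "hausdorff_dist C D < a" and b: "hausdorff_dist D E < b" using e by (auto simp: a_def b_def)
  note 1 = hausdorff_dist_less[OF C D a] and 2 = hausdorff_dist_less[OF D E b]
  have "hausdorff_dist C E \<le> a + b"
  proof (rule hausdorff_dist_le[OF C E])
    show "a + b > 0"
      using e hausdorff_dist_nonneg[OF C D] hausdorff_dist_nonneg[OF D E] by (simp add: a_def b_def)
    show "\<exists>d\<in>E. dist x d < a + b" if x: "x \<in> C" for x
    proof -
      obtain y where y: "y \<in> D" "dist x y < a" using 1(1) x by blast
      then obtain z where z: "z \<in> E" "dist y z < b" using 2(1) by blast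
      have "dist x z < a + b" using dist_triangle[of x z y] y z by linarith
      with z show ?thesis by blast
    qed
    show "\<exists>d\<in>C. dist x d < a + b" if x: "x \<in> E" for x
    proof -
      obtain y where y: "y \<in> D" "dist x y < b" using 2(2) x by blast
      then obtain z where z: "z \<in> C" "dist y z < a" using 1(2) by blast
      have "dist x z < a + b" using dist_triangle[of x z y] y z by linarith
      with z show ?thesis by blast
    qed
  qed
  then show "hausdorff_dist C E \<le> hausdorff_dist C D + hausdorff_dist D E + e"
    by (simp add: a_def b_def)
qed

lemma Metric_space_hausdorff:
  "Metric_space cbc_sets
     (\<lambda>C D. if C \<in> cbc_sets \<and> D \<in> cbc_sets then hausdorff_dist C D else 0)"
  by unfold_locales
     (auto simp: hausdorff_dist_nonneg hausdorff_dist_commute hausdorff_dist_zero_iff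
        hausdorff_dist_triangle)

lemma mspace_hausdorff_metric: "mspace hausdorff_metric = cbc_sets"
  unfolding hausdorff_metric_def by (rule Metric_space.mspace_metric[OF Metric_space_hausdorff])

lemma mdist_hausdorff_metric:
  "C \<in> cbc_sets \<Longrightarrow> D \<in> cbc_sets \<Longrightarrow> mdist hausdorff_metric C D = hausdorff_dist C D"
  unfolding hausdorff_metric_def by (simp add: Metric_space.mdist_metric[OF Metric_space_hausdorff])

end

theory Submission
  imports Defs
begin

text \<open>If every finite subset of the ball of radius \<open>r\<close> has a translate within \<open>e < r\<close> of a closed
  bounded convex set \<open>D\<close>, then the errors, rescaled by \<open>r / e\<close>, can be approximated again;
  summing the geometric series yields exact translates into \<open>D\<close> of all compact subsets of balls
  of radius less than \<open>r - e\<close>. This gives the Lipschitz property and, since every Borel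
  probability measure on a separable Banach space has a compact set of positive measure, that
  \<open>D\<close> is not Haar null if \<open>blr D > 0\<close>. Conversely, if \<open>blr D = 0\<close>, then at every scale
  there is a finitely supported measure giving mass at most \<open>15/16\<close> to each translate of a
  neighbourhood of \<open>D\<close>; otherwise averaging translations chosen by multiplicative weights would
  approximately translate every finite set into \<open>D\<close>. The law of a rapidly converging series of
  independent variables with these distributions vanishes on all translates of \<open>D\<close>.\<close>

section \<open>Translating compact sets into convex sets\<close>

text \<open>The coefficients add up to \<open>(1 - t ^ n) + t ^ n = 1\<close>. In the induction the
  last two terms merge into \<open>t ^ n\<close> times
  \<open>(1 - t) *\<^sub>R d n + t *\<^sub>R y\<close>, a point of \<open>D\<close> that takes over
  the role of \<open>y\<close>.\<close>

lemma geometric_combination_in_convex: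
  fixes D :: "'a::real_vector set"
  assumes "convex D" "0 \<le> t" "t \<le> 1" "\<And>j::nat. d j \<in> D" "y \<in> D"
  shows "(\<Sum>j<n. ((1 - t) * t ^ j) *\<^sub>R d j) + t ^ n *\<^sub>R y \<in> D"
  using assms(5)
proof (induction n arbitrary: y)
  case (Suc n)
  have "(1 - t) *\<^sub>R d n + t *\<^sub>R y \<in> D"
    using assms Suc.prems by (intro convexD) auto
  from Suc.IH[OF this] show ?case
    by (simp add: algebra_simps)
qed simp

text \<open>A translation that works up to \<open>e\<close> on a finite net of \<open>K\<close>
  works up to \<open>e'\<close> on all of \<open>K\<close>. The errors, rescaled by
  \<open>r / e'\<close>, again fill a compact subset of \<open>cball 0 r\<close>, because only
  finitely many points of \<open>D\<close> are subtracted; hence the step can be repeated.\<close>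

lemma approximate_translate_step:
  fixes D K :: "'a::real_normed_vector set"
  assumes H: "\<And>F. finite F \<Longrightarrow> F \<subseteq> cball 0 r \<Longrightarrow>
                \<exists>z\<in>cball 0 \<rho>. \<forall>f\<in>F. \<exists>d\<in>D. norm (f + z - d) \<le> e"
    and e: "e < e'" "0 < e'" and "0 < r" and K: "compact K" "K \<subseteq> cball 0 r"
  shows "\<exists>z K'. z \<in> cball 0 \<rho> \<and> compact K' \<and> K' \<subseteq> cball 0 r \<and>
           (\<forall>k\<in>K. \<exists>d\<in>D. \<exists>k'\<in>K'. k + z = d + (e' / r) *\<^sub>R k')"
proof -
  obtain F where F: "finite F" "F \<subseteq> K" "K \<subseteq> (\<Union>f\<in>F. ball f (e' - e))"
    using compactE_image[OF K(1), of K "\<lambda>f. ball f (e' - e)"] e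
    by (metis UN_I centre_in_ball diff_gt_0_iff_gt open_ball subsetI)
  obtain z where z: "z \<in> cball 0 \<rho>" "\<forall>f\<in>F. \<exists>d\<in>D. norm (f + z - d) \<le> e"
    using H[of F] F K by blast
  then obtain d where d: "\<And>f. f \<in> F \<Longrightarrow> d f \<in> D \<and> norm (f + z - d f) \<le> e"
    by metis
  \<comment> \<open>For each \<open>f\<close>, the intersection with the ball discards the points of
    \<open>K\<close> whose error relative to \<open>d f\<close> exceeds \<open>e'\<close>.\<close>
  define K' where "K' = (\<Union>f\<in>F. (\<lambda>k. (r / e') *\<^sub>R (k + z - d f)) ` K \<inter> cball 0 r)"
  have "compact ((\<lambda>k. (r / e') *\<^sub>R (k + z - d f)) ` K \<inter> cball 0 r)" for f
    by (intro compact_Int_closed compact_continuous_image continuous_intros K closed_cball)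
  then have cK': "compact K'" unfolding K'_def using F(1) by (intro compact_UN) auto
  have scale: "(r / e') *\<^sub>R v \<in> cball 0 r" if "norm v \<le> e'" for v :: 'a
  proof -
    have "r / e' * norm v \<le> r / e' * e'" using that assms(4) e by (intro mult_left_mono) auto
    then show ?thesis using assms(4) e by simp
  qed
  have "\<exists>d\<in>D. \<exists>k'\<in>K'. k + z = d + (e' / r) *\<^sub>R k'" if k: "k \<in> K" for k
  proof -
    obtain f where f: "f \<in> F" "norm (f - k) < e' - e"
      using F(3) k by (auto simp: dist_norm)
    have "norm (k + z - d f) \<le> norm (f + z - d f) + norm (f - k)"
      using norm_triangle_ineq4[of "f + z - d f" "f - k"] by (simp add: algebra_simps)
    also have "\<dots> \<le> e'" using d[OF f(1)] f(2) by linarith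
    finally have "norm (k + z - d f) \<le> e'" .
    then have "(r / e') *\<^sub>R (k + z - d f) \<in> cball 0 r" by (rule scale)
    then have "(r / e') *\<^sub>R (k + z - d f) \<in> K'" using k f unfolding K'_def by blast
    moreover have "k + z = d f + (e' / r) *\<^sub>R ((r / e') *\<^sub>R (k + z - d f))"
      using assms(4) e by simp
    ultimately show ?thesis using d[OF f(1)] by blast
  qed
  moreover have "K' \<subseteq> cball 0 r" unfolding K'_def by blast
  ultimately show ?thesis using z(1) cK' by (intro exI[of _ z] exI[of _ K'] conjI ballI) auto
qed

text \<open>With \<open>t = e' / r\<close>, iterating the previous lemma expands \<open>k\<close> as a series
  \<open>\<Sum>j. t ^ j * (d j - z j)\<close> in which only the \<open>d j\<close> in \<open>D\<close> depend on \<open>k\<close>.\<close>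

lemma compact_translate_into:
  fixes D K :: "'a::banach set"
  assumes D: "D \<in> cbc_sets"
    and H: "\<And>F. finite F \<Longrightarrow> F \<subseteq> cball 0 r \<Longrightarrow>
              \<exists>z\<in>cball 0 \<rho>. \<forall>f\<in>F. \<exists>d\<in>D. norm (f + z - d) \<le> e"
    and e: "e < e'" "0 < e'" "e' < r" and K: "compact K" "K \<subseteq> cball 0 (r - e')"
  shows "\<exists>z\<in>cball 0 \<rho>. \<forall>k\<in>K. z + k \<in> D"
proof -
  define t where "t = e' / r"
  have t: "0 < t" "t < 1" and r: "0 < r" using e by (auto simp: t_def)
  define P where "P = (\<lambda>K :: 'a set. compact K \<and> K \<subseteq> cball 0 r)"
  \<comment> \<open>With \<open>P K\<close> as a premise, the statement holds for every
    \<open>K\<close>, so choice yields total functions \<open>zf\<close> and \<open>Kf\<close>, and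
    \<open>Kf\<close> can be iterated.\<close>
  have "\<exists>z K'. P K \<longrightarrow> z \<in> cball 0 \<rho> \<and> P K' \<and> (\<forall>k\<in>K. \<exists>d\<in>D. \<exists>k'\<in>K'. k + z = d + t *\<^sub>R k')" for K
  proof (cases "P K")
    case True
    then show ?thesis
      using approximate_translate_step[OF H e(1,2) r, of K] unfolding P_def t_def by simp
  qed simp
  then obtain zf Kf where zK: "\<And>K. P K \<longrightarrow> zf K \<in> cball 0 \<rho> \<and> P (Kf K) \<and>
      (\<forall>k\<in>K. \<exists>d\<in>D. \<exists>k'\<in>Kf K. k + zf K = d + t *\<^sub>R k')"
    by metis
  have zf: "zf K \<in> cball 0 \<rho>" and Kf: "P (Kf K)"
    and zKf: "k \<in> K \<Longrightarrow> \<exists>d\<in>D. \<exists>k'\<in>Kf K. k + zf K = d + t *\<^sub>R k'" if "P K" for K k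
    using zK[of K] that by meson+
  \<comment> \<open>The final factor \<open>1 - t\<close>, which turns the geometric weights into
    convex ones, is compensated in advance. As \<open>r - e' = r * (1 - t)\<close>, the enlarged set
    still lies in \<open>cball 0 r\<close>.\<close>
  define K0 where "K0 = (\<lambda>k. (1 / (1 - t)) *\<^sub>R k) ` K"
  have "norm k \<le> r * (1 - t)" if "k \<in> K" for k
    using K(2) that r by (auto simp: t_def algebra_simps)
  then have "norm ((1 / (1 - t)) *\<^sub>R k) \<le> r" if "k \<in> K" for k
    using t that by (simp add: pos_divide_le_eq)
  then have "K0 \<subseteq> cball 0 r" unfolding K0_def by auto
  moreover have "compact K0"
    unfolding K0_def by (intro compact_continuous_image continuous_intros K(1))
  ultimately have "P K0" unfolding P_def by blast
  define Ks where "Ks = (\<lambda>n. (Kf ^^ n) K0)"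
  define z where "z = (\<lambda>n. zf (Ks n))"
  have PK: "P (Ks n)" for n
  proof (induction n)
    case 0 show ?case using \<open>P K0\<close> by (simp add: Ks_def)
  next
    case (Suc n) show ?case using Kf[OF Suc] by (simp add: Ks_def)
  qed
  have z: "norm (z n) \<le> \<rho>" for n using zf[OF PK] by (simp add: z_def)
  have KsS: "Ks (Suc n) = Kf (Ks n)" for n by (simp add: Ks_def)
  define Q where "Q = (\<lambda>n k p. fst p \<in> D \<and> snd p \<in> Ks (Suc n) \<and>
      k + z n = fst p + t *\<^sub>R snd p)"
  have "\<exists>p. Q n k p" if "k \<in> Ks n" for n k
    using zKf[OF PK that]
    by (elim bexE) (rule exI[of _ "(d, k')" for d k'], simp add: Q_def KsS z_def)
  then have p: "Q n k (SOME p. Q n k p)" if "k \<in> Ks n" for n k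
    using that someI_ex by fast
  have geo: "summable (\<lambda>j. c * t ^ j)" "(\<Sum>j. c * t ^ j) = c / (1 - t)" for c
    using t by (auto simp: suminf_mult suminf_geometric summable_geometric)
  have nz: "norm (t ^ j *\<^sub>R z j) \<le> \<rho> * t ^ j" for j
    using z[of j] t by (simp add: mult.commute mult_right_mono)
  have sz: "summable (\<lambda>j. t ^ j *\<^sub>R z j)"
    by (rule summable_comparison_test'[OF geo(1) nz])
  define Z where "Z = (1 - t) *\<^sub>R (\<Sum>j. t ^ j *\<^sub>R z j)"
  have "norm (\<Sum>j. t ^ j *\<^sub>R z j) \<le> (\<Sum>j. \<rho> * t ^ j)"
    by (rule norm_suminf_le[OF nz geo(1)])
  then have "(1 - t) * norm (\<Sum>j. t ^ j *\<^sub>R z j) \<le> (1 - t) * (\<rho> / (1 - t))"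
    using t by (intro mult_left_mono) (simp_all add: geo)
  then have "norm Z \<le> \<rho>" using t by (simp add: Z_def del: scaleR_left_diff_distrib)
  moreover have "Z + k \<in> D" if "k \<in> K" for k
  proof -
    define k0 where "k0 = (1 / (1 - t)) *\<^sub>R k"
    define ks where "ks = rec_nat k0 (\<lambda>n k. snd (SOME p. Q n k p))"
    have ks: "ks n \<in> Ks n" for n
    proof (induction n)
      case 0 then show ?case using that by (auto simp: ks_def Ks_def K0_def k0_def)
    next
      case (Suc n) then show ?case using p[of "ks n" n] by (simp add: ks_def Q_def)
    qed
    define d where "d = (\<lambda>n. fst (SOME p. Q n (ks n) p))"
    have d: "d n \<in> D" for n using p[OF ks] by (simp add: d_def Q_def)
    have eq: "ks n + z n = d n + t *\<^sub>R ks (Suc n)" for n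
      using p[OF ks[of n]] by (simp add: d_def ks_def Q_def)
    have exp: "k0 + (\<Sum>j<n. t ^ j *\<^sub>R z j) = (\<Sum>j<n. t ^ j *\<^sub>R d j) + t ^ n *\<^sub>R ks n" for n
    proof (induction n)
      case 0 show ?case by (simp add: ks_def)
    next
      case (Suc n)
      have "k0 + (\<Sum>j<Suc n. t ^ j *\<^sub>R z j) = (\<Sum>j<n. t ^ j *\<^sub>R d j) + t ^ n *\<^sub>R (ks n + z n)"
        using Suc.IH by (simp add: algebra_simps)
      then show ?case by (simp add: eq algebra_simps)
    qed
    \<comment> \<open>The remainder \<open>t ^ n *\<^sub>R ks n\<close> of the expansion is replaced
      by the point \<open>d 0\<close> of \<open>D\<close> with the missing weight
      \<open>t ^ n\<close>. This puts \<open>a n\<close> into \<open>D\<close> and does not change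
      the limit.\<close>
    define a where "a = (\<lambda>n. (1 - t) *\<^sub>R (k0 + (\<Sum>j<n. t ^ j *\<^sub>R z j))
        + t ^ n *\<^sub>R (d 0 - (1 - t) *\<^sub>R ks n))"
    have "a n = (\<Sum>j<n. ((1 - t) * t ^ j) *\<^sub>R d j) + t ^ n *\<^sub>R d 0" for n
      unfolding a_def exp by (simp add: algebra_simps scaleR_sum_right)
    then have aD: "a n \<in> D" for n
      using geometric_combination_in_convex[of D t d "d 0" n] D d t by (simp add: cbc_sets_def)
    have "bounded (range (\<lambda>n. d 0 - (1 - t) *\<^sub>R ks n))"
    proof (intro boundedI[of _ "norm (d 0) + r"], clarify)
      fix n
      have "norm (ks n) \<le> r" using ks[of n] PK[of n] by (auto simp: P_def)
      moreover have "(1 - t) * norm (ks n) \<le> norm (ks n)" using t by (simp add: mult_left_le_one_le)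
      moreover have "norm (d 0 - (1 - t) *\<^sub>R ks n) \<le> norm (d 0) + (1 - t) * norm (ks n)"
        using norm_triangle_ineq4[of "d 0" "(1 - t) *\<^sub>R ks n"] t by simp
      ultimately show "norm (d 0 - (1 - t) *\<^sub>R ks n) \<le> norm (d 0) + r" by linarith
    qed
    then have "Bfun (\<lambda>n. d 0 - (1 - t) *\<^sub>R ks n) sequentially"
      by (simp add: Bseq_eq_bounded)
    moreover have "(\<lambda>n. t ^ n) \<longlonglongrightarrow> 0" using t by (intro LIMSEQ_realpow_zero) auto
    ultimately have "(\<lambda>n. t ^ n *\<^sub>R (d 0 - (1 - t) *\<^sub>R ks n)) \<longlonglongrightarrow> 0"
      using bounded_bilinear.Zfun_prod_Bfun[OF bounded_bilinear_scaleR]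
      unfolding tendsto_Zfun_iff by simp
    then have "a \<longlonglongrightarrow> (1 - t) *\<^sub>R (k0 + (\<Sum>j. t ^ j *\<^sub>R z j)) + 0"
      unfolding a_def by (intro tendsto_intros summable_LIMSEQ sz)
    moreover have "(1 - t) *\<^sub>R (k0 + (\<Sum>j. t ^ j *\<^sub>R z j)) + 0 = Z + k"
      using t by (simp add: Z_def k0_def algebra_simps)
    ultimately show ?thesis
      using closed_sequentially[of D a "Z + k"] D aD by (auto simp: cbc_sets_def)
  qed
  ultimately show ?thesis by (intro bexI[of _ Z]) auto
qed

section \<open>The bounded loose radius\<close>

lemma loose_admissible_finite:
  assumes "loose_admissible C \<rho> r" "finite F" "F \<subseteq> cball 0 r" "0 < \<epsilon>"
  shows "\<exists>z\<in>cball 0 \<rho>. \<forall>f\<in>F. \<exists>c\<in>C. norm (f + z - c) < \<epsilon>"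
proof -
  obtain x :: "nat \<Rightarrow> 'a" and n where x: "F = x ` {1..n}"
    using ex_bij_betw_nat_finite_1[OF assms(2)] unfolding bij_betw_def by metis
  then have xr: "(\<forall>j\<in>{1..n}. x j \<in> cball 0 r) \<and> 0 < \<epsilon>" using assms(3,4) by blast
  obtain y z where y: "z \<in> cball 0 \<rho>"
      "\<forall>j\<in>{1..n}. norm (x j - y j) < \<epsilon>" "\<forall>j\<in>{1..n}. z + y j \<in> C"
    using assms(1)[unfolded loose_admissible_def, THEN spec, THEN spec, THEN spec, THEN mp, OF xr]
    by (elim exE bexE conjE)
  have "\<exists>c\<in>C. norm (f + z - c) < \<epsilon>" if "f \<in> F" for f
  proof -
    from that x obtain j where j: "j \<in> {1..n}" "f = x j" by blast
    have "x j + z - (z + y j) = x j - y j" by simp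
    with y j show ?thesis by (intro bexI[of _ "z + y j"]) simp_all
  qed
  with y(1) show ?thesis by blast
qed

lemma loose_admissibleI:
  assumes "\<And>F. finite F \<Longrightarrow> F \<subseteq> cball 0 r \<Longrightarrow> \<exists>z\<in>cball 0 \<rho>. \<forall>f\<in>F. z + f \<in> C"
  shows "loose_admissible C \<rho> r"
  unfolding loose_admissible_def
proof (intro allI impI)
  fix n :: nat and x :: "nat \<Rightarrow> 'a" and \<epsilon> :: real
  assume x: "(\<forall>j\<in>{1..n}. x j \<in> cball 0 r) \<and> \<epsilon> > 0"
  then obtain z where "z \<in> cball 0 \<rho>" "\<forall>f\<in>x ` {1..n}. z + f \<in> C"
    using assms[of "x ` {1..n}"] by blast
  then show "\<exists>y. \<exists>z\<in>cball 0 \<rho>. (\<forall>j\<in>{1..n}. norm (x j - y j) < \<epsilon>) \<and> (\<forall>j\<in>{1..n}. z + y j \<in> C)"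
    using x by (intro exI[of _ x] bexI[of _ z]) auto
qed

text \<open>Finite sets are compact, so \<open>compact_translate_into\<close> makes
  \<open>r - e'\<close> admissible for every \<open>e'\<close> strictly between \<open>e\<close> and
  \<open>r\<close>; then \<open>e'\<close> tends to \<open>e\<close>. This is how a fixed error in
  the translations becomes a lower bound for the radius.\<close>

lemma loose_radius_ge:
  fixes D :: "'a::banach set"
  assumes D: "D \<in> cbc_sets"
    and H: "\<And>F. finite F \<Longrightarrow> F \<subseteq> cball 0 r \<Longrightarrow>
              \<exists>z\<in>cball 0 \<rho>. \<forall>f\<in>F. \<exists>d\<in>D. norm (f + z - d) \<le> e"
    and e: "0 \<le> e" "e < r"
  shows "ennreal (r - e) \<le> loose_radius D \<rho>"
proof (rule ennreal_le_epsilon)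
  fix \<delta> :: real assume "0 < \<delta>"
  define e' where "e' = e + min \<delta> ((r - e) / 2)"
  have e': "e < e'" "0 < e'" "e' < r" "e' - e \<le> \<delta>"
    using e \<open>0 < \<delta>\<close> by (auto simp: e'_def min_def field_simps)
  have "loose_admissible D \<rho> (r - e')"
    using compact_translate_into[OF D H e'(1-3)]
    by (intro loose_admissibleI) (auto simp: finite_imp_compact)
  then have "ennreal (r - e') \<le> loose_radius D \<rho>"
    unfolding loose_radius_def using e' by (intro SUP_upper) auto
  then have "ennreal (r - e') + ennreal (e' - e) \<le> loose_radius D \<rho> + ennreal \<delta>"
    using e' by (intro add_mono) (auto intro: ennreal_leI)
  then show "ennreal (r - e) \<le> loose_radius D \<rho> + ennreal \<delta>"
    using e' by (simp flip: ennreal_plus)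
qed

lemma loose_radius_le_bounded_loose_radius:
  "0 < \<rho> \<Longrightarrow> loose_radius C \<rho> \<le> bounded_loose_radius C"
  unfolding bounded_loose_radius_def by (intro SUP_upper) auto

text \<open>A finite set translated almost into \<open>C\<close> is within about
  \<open>hausdorff_dist C D\<close> of \<open>D\<close> after the same translation, so an admissible
  \<open>r\<close> for \<open>C\<close> costs at most \<open>e\<close> when passing to
  \<open>D\<close>.\<close>

lemma bounded_loose_radius_le_add:
  fixes C D :: "'a::banach set"
  assumes CD: "C \<in> cbc_sets" "D \<in> cbc_sets" and e: "hausdorff_dist C D < e"
  shows "bounded_loose_radius C \<le> bounded_loose_radius D + ennreal e"
proof -
  have "ennreal r \<le> bounded_loose_radius D + ennreal e"
    if \<rho>: "0 < \<rho>" and r: "0 \<le> r" "loose_admissible C \<rho> r" for \<rho> r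
  proof (cases "r \<le> e")
    case True
    then show ?thesis by (intro add_increasing ennreal_leI) auto
  next
    case False
    \<comment> \<open>The gap \<open>e - e0\<close> is the error allowed for reaching
      \<open>C\<close>; the remaining \<open>e0\<close> covers the way from \<open>C\<close> to
      \<open>D\<close>.\<close>
    obtain e0 where e0: "hausdorff_dist C D < e0" "e0 < e" using dense[OF e] by blast
    then have "0 < e" using hausdorff_dist_nonneg[OF CD] by linarith
    have "\<exists>z\<in>cball 0 \<rho>. \<forall>f\<in>F. \<exists>d\<in>D. norm (f + z - d) \<le> e"
      if F: "finite F" "F \<subseteq> cball 0 r" for F
    proof -
      obtain z where z: "z \<in> cball 0 \<rho>" "\<forall>f\<in>F. \<exists>c\<in>C. norm (f + z - c) < e - e0"
        using loose_admissible_finite[OF r(2) F, of "e - e0"] e0 by auto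
      have "\<exists>d\<in>D. norm (f + z - d) \<le> e" if f: "f \<in> F" for f
      proof -
        obtain c where c: "c \<in> C" "norm (f + z - c) < e - e0" using z(2) f by blast
        moreover obtain d where "d \<in> D" "dist c d < e0"
          using hausdorff_dist_less(1)[OF CD e0(1)] c by blast
        moreover have "norm (f + z - d) \<le> norm (f + z - c) + dist c d"
          using norm_triangle_ineq[of "f + z - c" "c - d"] by (simp add: dist_norm)
        ultimately have "norm (f + z - d) \<le> e" by linarith
        with \<open>d \<in> D\<close> show ?thesis by (rule bexI[rotated])
      qed
      then show ?thesis by (intro bexI[OF _ z(1)] ballI)
    qed
    then have "ennreal (r - e) \<le> loose_radius D \<rho>"
      using False \<open>0 < e\<close> by (intro loose_radius_ge[OF CD(2)]) simp_all
    also have "\<dots> \<le> bounded_loose_radius D" by (rule loose_radius_le_bounded_loose_radius[OF \<rho>])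
    finally have "ennreal (r - e) + ennreal e \<le> bounded_loose_radius D + ennreal e"
      by (rule add_right_mono)
    then show ?thesis using False \<open>0 < e\<close> by (simp flip: ennreal_plus)
  qed
  then show ?thesis
    unfolding bounded_loose_radius_def[of C] loose_radius_def by (intro SUP_least) auto
qed

lemma bounded_loose_radius_lipschitz:
  fixes C D :: "'a::banach set"
  assumes CD: "C \<in> cbc_sets" "D \<in> cbc_sets"
  shows "\<bar>enn2real (bounded_loose_radius C) - enn2real (bounded_loose_radius D)\<bar> \<le> hausdorff_dist C D"
proof (rule field_le_epsilon)
  fix \<delta> :: real assume "0 < \<delta>"
  define e where "e = hausdorff_dist C D + \<delta>"
  have e: "hausdorff_dist C D < e" "hausdorff_dist D C < e" "0 \<le> e"
    using \<open>0 < \<delta>\<close> hausdorff_dist_nonneg[OF CD] by (auto simp: e_def hausdorff_dist_commute)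
  note le = bounded_loose_radius_le_add[OF CD e(1)] bounded_loose_radius_le_add[OF CD(2,1) e(2)]
  \<comment> \<open>By the two estimates the radii are both finite or both infinite; in the second
    case \<open>enn2real\<close> sends both to 0.\<close>
  have "\<bar>enn2real (bounded_loose_radius C) - enn2real (bounded_loose_radius D)\<bar> \<le> e"
    using le e(3)
    by (cases "bounded_loose_radius C"; cases "bounded_loose_radius D")
       (auto simp: top_unique simp flip: ennreal_plus)
  then show "\<bar>enn2real (bounded_loose_radius C) - enn2real (bounded_loose_radius D)\<bar>
      \<le> hausdorff_dist C D + \<delta>"
    by (simp add: e_def)
qed

text \<open>Translates of the antipodal points \<open>u\<close> and \<open>- u\<close> of norm
  \<open>r\<close> still differ by \<open>2 *\<^sub>R u\<close>, whereas points of \<open>C\<close>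
  differ by at most \<open>2 * R\<close>. A nonzero vector is what provides
  \<open>u\<close>.\<close>

lemma bounded_loose_radius_finite:
  fixes C :: "'a::real_normed_vector set"
  assumes "bounded C" "x \<noteq> (0 :: 'a)"
  shows "bounded_loose_radius C < \<top>"
proof -
  obtain R where R: "\<And>c. c \<in> C \<Longrightarrow> norm c \<le> R" using assms(1) by (auto simp: bounded_iff)
  have "r \<le> R + 1" if r: "0 \<le> r" "loose_admissible C \<rho> r" for \<rho> r
  proof -
    define u where "u = (r / norm x) *\<^sub>R x"
    have u: "norm u = r" using assms(2) r by (simp add: u_def)
    obtain z where z: "\<forall>f\<in>{u, - u}. \<exists>c\<in>C. norm (f + z - c) < 1"
      using loose_admissible_finite[OF r(2), of "{u, - u}" 1] u by auto
    then obtain c c' where c: "c \<in> C" "norm (u + z - c) < 1" "c' \<in> C" "norm (- u + z - c') < 1"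
      by auto
    have "2 *\<^sub>R u = (u + z - c) - (- u + z - c') + (c - c')" by (simp add: scaleR_2)
    then have "norm (2 *\<^sub>R u) \<le> norm (u + z - c) + norm (- u + z - c') + (norm c + norm c')"
      by (metis add_mono norm_triangle_ineq4 norm_triangle_le)
    then show ?thesis using c R[of c] R[of c'] u by simp
  qed
  then have "bounded_loose_radius C \<le> ennreal (R + 1)"
    unfolding bounded_loose_radius_def loose_radius_def by (intro SUP_least ennreal_leI) auto
  then show ?thesis by (simp add: le_less_trans)
qed

section \<open>Haar positivity\<close>

text \<open>Ulam's tightness argument: at each scale \<open>1 / Suc m\<close>, finitely many balls
  around a dense sequence carry almost all the mass. The intersection over all scales is closed and
  totally bounded, hence compact by completeness.\<close>

lemma exists_compact_positive_measure:
  fixes \<mu> :: "'a::banach measure"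
  assumes sep: "separable_space (euclidean :: 'a topology)"
    and \<mu>: "prob_space \<mu>" "sets \<mu> = sets borel"
  shows "\<exists>K. compact K \<and> measure \<mu> K > 0"
proof -
  interpret prob_space \<mu> by fact
  have space: "space \<mu> = UNIV" using sets_eq_imp_space_eq[OF \<mu>(2)] by simp
  obtain S :: "'a set" where S: "countable S" "closure S = UNIV"
    using sep unfolding separable_space_def by auto
  then have "S \<noteq> {}" by auto
  define d where "d = from_nat_into S"
  have dense: "\<exists>i. dist (d i) x < \<delta>" if "0 < \<delta>" for x \<delta>
    using S that range_from_nat_into[OF \<open>S \<noteq> {}\<close> S(1)] closure_approachable[of x S]
    unfolding d_def by (metis UNIV_I imageE)
  define B where "B = (\<lambda>m n. \<Union>i<n. cball (d i) (1 / real (Suc m)))"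
  have clB: "closed (B m n)" for m n unfolding B_def by auto
  \<comment> \<open>The tolerances add up to \<open>1 / 2\<close> over all \<open>m\<close>, so at
    least half of the mass survives in the intersection.\<close>
  have "\<exists>n. measure \<mu> (B m n) > 1 - (1 / 4) * (1 / 2) ^ m" for m
  proof -
    have "(\<lambda>n. measure \<mu> (B m n)) \<longlonglongrightarrow> measure \<mu> (\<Union>n. B m n)"
    proof (rule finite_Lim_measure_incseq)
      show "range (B m) \<subseteq> sets \<mu>" using clB \<mu>(2) by auto
      show "incseq (B m)" unfolding B_def by (intro monoI UN_mono) auto
    qed
    moreover have "(\<Union>n. B m n) = UNIV"
    proof -
      have "x \<in> (\<Union>n. B m n)" for x
      proof -
        obtain i where "dist (d i) x < 1 / real (Suc m)" using dense[of "1 / real (Suc m)" x] by auto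
        then have "x \<in> B m (Suc i)" unfolding B_def by (intro UN_I[of i]) auto
        then show ?thesis by blast
      qed
      then show ?thesis by blast
    qed
    ultimately have "(\<lambda>n. measure \<mu> (B m n)) \<longlonglongrightarrow> 1" using prob_space space by simp
    then have "eventually (\<lambda>n. measure \<mu> (B m n) > 1 - (1 / 4) * (1 / 2) ^ m) sequentially"
      by (rule order_tendstoD) simp
    then show ?thesis by (auto simp: eventually_sequentially)
  qed
  then obtain N where N: "\<And>m. measure \<mu> (B m (N m)) > 1 - (1 / 4) * (1 / 2) ^ m" by metis
  define K where "K = (\<Inter>m. B m (N m))"
  have "closed K" unfolding K_def using clB by blast
  have "compact K"
    unfolding compact_eq_totally_bounded
  proof (intro conjI allI impI)
    show "Topological_Spaces.complete K" using \<open>closed K\<close> by (simp add: complete_eq_closed)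
    fix \<epsilon> :: real assume "0 < \<epsilon>"
    then obtain m where m: "1 / real (Suc m) < \<epsilon>" by (rule nat_approx_posE)
    have "K \<subseteq> B m (N m)" unfolding K_def by blast
    also have "\<dots> \<subseteq> (\<Union>x\<in>d ` {..<N m}. ball x \<epsilon>)" using m unfolding B_def by fastforce
    finally show "\<exists>k. finite k \<and> K \<subseteq> (\<Union>x\<in>k. ball x \<epsilon>)" by blast
  qed
  have s: "(\<lambda>m. (1 / 4) * (1 / 2) ^ m) sums (1 / 2 :: real)"
    using sums_mult[OF geometric_sums[of "1 / 2 :: real"], of "1 / 4"] by simp
  have co: "measure \<mu> (- B m (N m)) \<le> (1 / 4) * (1 / 2) ^ m" for m
    using N[of m] prob_compl[of "B m (N m)"] clB \<mu>(2) space by (simp add: Compl_eq_Diff_UNIV)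
  have sm: "summable (\<lambda>m. measure \<mu> (- B m (N m)))"
    by (rule summable_comparison_test'[OF sums_summable[OF s]]) (use co in auto)
  have "measure \<mu> (\<Union>m. - B m (N m)) \<le> (\<Sum>m. measure \<mu> (- B m (N m)))"
    by (rule finite_measure_subadditive_countably) (use clB \<mu>(2) sm in auto)
  also have "\<dots> \<le> 1 / 2"
    using suminf_le[OF co sm sums_summable[OF s]] sums_unique[OF s] by simp
  finally have "measure \<mu> (- K) \<le> 1 / 2" unfolding K_def by simp
  then have "measure \<mu> K > 0"
    using prob_compl[of K] \<open>closed K\<close> \<mu>(2) space by (simp add: Compl_eq_Diff_UNIV)
  with \<open>compact K\<close> show ?thesis by blast
qed

text \<open>A compact \<open>K\<close> of positive measure is cut into finitely many pieces of
  radius \<open>r / 2\<close>. Each piece, recentred at the origin, translates exactly into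
  \<open>C\<close>, so it would be null for a measure vanishing on all translates of
  \<open>C\<close>, and so would \<open>K\<close>.\<close>

lemma not_haar_null_if_bounded_loose_radius_pos:
  fixes C :: "'a::banach set"
  assumes sep: "separable_space (euclidean :: 'a topology)"
    and C: "C \<in> cbc_sets" and pos: "0 < bounded_loose_radius C"
  shows "\<not> haar_null C"
proof
  assume "haar_null C"
  then obtain \<mu> where \<mu>: "prob_space \<mu>" "sets \<mu> = sets borel"
    and null: "\<And>x. emeasure \<mu> ((\<lambda>e. x + e) ` C) = 0"
    unfolding haar_null_def by blast
  interpret prob_space \<mu> by fact
  obtain \<rho> r where r: "0 < r" "loose_admissible C \<rho> r"
    using pos unfolding bounded_loose_radius_def loose_radius_def less_SUP_iff by auto
  obtain K where K: "compact K" "measure \<mu> K > 0"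
    using exists_compact_positive_measure[OF sep \<mu>] by blast
  obtain F where F: "finite F" "K \<subseteq> (\<Union>f\<in>F. ball f (r / 2))"
    using K(1)[unfolded compact_eq_totally_bounded, THEN conjunct2, rule_format, OF half_gt_zero[OF r(1)]]
    by (elim exE conjE)
  have "emeasure \<mu> (K \<inter> cball f (r / 2)) = 0" for f
  proof -
    have "\<exists>z\<in>cball 0 \<rho>. \<forall>k\<in>(\<lambda>k. k - f) ` (K \<inter> cball f (r / 2)). z + k \<in> C"
    \<comment> \<open>With these values, exact translation is available on the ball of radius
      \<open>r - e' = r / 2\<close>, the radius of the pieces.\<close>
    proof (rule compact_translate_into[OF C, where r = r and e = "r / 4" and e' = "r / 2"])
      show "\<exists>z\<in>cball 0 \<rho>. \<forall>f\<in>F. \<exists>d\<in>C. norm (f + z - d) \<le> r / 4"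
        if F: "finite F" "F \<subseteq> cball 0 r" for F
      proof -
        obtain z where "z \<in> cball 0 \<rho>" "\<forall>f\<in>F. \<exists>c\<in>C. norm (f + z - c) < r / 4"
          using loose_admissible_finite[OF r(2) F, of "r / 4"] r(1) by auto
        then show ?thesis by (intro bexI[of _ z]) (auto intro: less_imp_le)
      qed
      show "compact ((\<lambda>k. k - f) ` (K \<inter> cball f (r / 2)))"
        by (intro compact_continuous_image continuous_intros compact_Int_closed K(1) closed_cball)
    qed (use r(1) in \<open>auto simp: dist_norm norm_minus_commute\<close>)
    then obtain z where "\<forall>k\<in>(\<lambda>k. k - f) ` (K \<inter> cball f (r / 2)). z + k \<in> C" by (elim bexE)
    then have z: "z + (k - f) \<in> C" if "k \<in> K \<inter> cball f (r / 2)" for k using that by blast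
    have "K \<inter> cball f (r / 2) \<subseteq> (\<lambda>e. (f - z) + e) ` C"
    proof
      fix k assume "k \<in> K \<inter> cball f (r / 2)"
      then show "k \<in> (\<lambda>e. (f - z) + e) ` C"
        using z by (intro image_eqI[of _ _ "z + (k - f)"]) auto
    qed
    moreover have "(\<lambda>e. (f - z) + e) ` C \<in> sets \<mu>"
      using C \<mu>(2) closed_translation[of C "f - z"] by (auto simp: cbc_sets_def)
    ultimately show ?thesis using null[of "f - z"] emeasure_mono[of _ _ \<mu>] by (metis le_zero_eq)
  qed
  moreover have "(\<lambda>f. K \<inter> cball f (r / 2)) ` F \<subseteq> sets \<mu>"
    using K(1) by (auto simp: \<mu>(2) intro!: borel_closed closed_Int compact_imp_closed)
  ultimately have "emeasure \<mu> (\<Union>f\<in>F. K \<inter> cball f (r / 2)) \<le> 0"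
    using emeasure_subadditive_finite[OF F(1), of "\<lambda>f. K \<inter> cball f (r / 2)" \<mu>] by simp
  moreover have "K \<subseteq> (\<Union>f\<in>F. K \<inter> cball f (r / 2))"
  proof
    fix k assume k: "k \<in> K"
    then obtain f where "f \<in> F" "k \<in> ball f (r / 2)" using F(2) by blast
    with k show "k \<in> (\<Union>f\<in>F. K \<inter> cball f (r / 2))" by (intro UN_I[of f]) auto
  qed
  then have "(\<Union>f\<in>F. K \<inter> cball f (r / 2)) = K" by (intro equalityI) auto
  ultimately show False using K(2) by (simp add: measure_def)
qed

section \<open>Escaping measures\<close>

text \<open>Multiplicative weights: a point counted \<open>c\<close> times so far gets weight \<open>(1/2) ^ c\<close>, so each
  step multiplies the total weight by at most \<open>17/32\<close>, and \<open>(17/32) ^ 4 < 1/8\<close>.\<close>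

lemma balanced_sequence_of_covering_sets:
  fixes A :: "'c \<Rightarrow> 'b set"
  assumes F: "finite F" "F \<noteq> {}"
    and cover: "\<And>w :: 'b \<Rightarrow> real. (\<And>f. f \<in> F \<Longrightarrow> 0 < w f) \<Longrightarrow>
                  \<exists>x. 15 / 16 * sum w F \<le> sum w (F \<inter> A x)"
  shows "\<exists>M x. 0 < M \<and> (\<forall>i. F \<inter> A (x i) \<noteq> {}) \<and>
           (\<forall>f\<in>F. 3 * M \<le> card {i\<in>{..<4 * M}. f \<in> A (x i)})"
proof -
  let ?w = "\<lambda>(c :: 'b \<Rightarrow> nat) f. (1 / 2 :: real) ^ c f"
  have "\<exists>x. 15 / 16 * sum (?w c) F \<le> sum (?w c) (F \<inter> A x)" for c
    by (rule cover) simp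
  then obtain X where X: "\<And>c. 15 / 16 * sum (?w c) F \<le> sum (?w c) (F \<inter> A (X c))" by metis
  \<comment> \<open>\<open>cs n f\<close> counts the steps before \<open>n\<close> whose chosen set
    contains \<open>f\<close>; the next choice is made for the weights given by these
    counts.\<close>
  define cs where "cs = rec_nat (\<lambda>_. 0) (\<lambda>_ c f. c f + of_bool (f \<in> A (X c)))"
  define x where "x = (\<lambda>n. X (cs n))"
  have cs0: "cs 0 f = 0" and csS: "cs (Suc n) f = cs n f + of_bool (f \<in> A (x n))" for n f
    by (simp_all add: cs_def x_def)
  have cs: "cs n f = card {i\<in>{..<n}. f \<in> A (x i)}" for n f
  proof (induction n)
    case (Suc n)
    have "{i\<in>{..<Suc n}. f \<in> A (x i)} =
        (if f \<in> A (x n) then insert n {i\<in>{..<n}. f \<in> A (x i)} else {i\<in>{..<n}. f \<in> A (x i)})"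
      by (auto simp: less_Suc_eq)
    with Suc csS show ?case by simp
  qed (simp add: cs0)
  have ne: "F \<inter> A (x i) \<noteq> {}" for i
  proof
    assume "F \<inter> A (x i) = {}"
    with X[of "cs i"] have "sum (?w (cs i)) F \<le> 0" by (simp add: x_def)
    moreover have "sum (?w (cs i)) F > 0" using F by (intro sum_pos) auto
    ultimately show False by simp
  qed
  have pot: "sum (?w (cs n)) F \<le> real (card F) * (17 / 32) ^ n" for n
  proof (induction n)
    case (Suc n)
    have "?w (cs (Suc n)) f = ?w (cs n) f - 1 / 2 * (if f \<in> A (x n) then ?w (cs n) f else 0)" for f
      by (simp add: csS)
    then have "sum (?w (cs (Suc n))) F
        = sum (?w (cs n)) F - 1 / 2 * sum (?w (cs n)) (F \<inter> A (x n))"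
      using F(1) by (simp add: sum_subtractf sum.inter_restrict sum_divide_distrib)
    also have "\<dots> \<le> 17 / 32 * sum (?w (cs n)) F" using X[of "cs n"] by (simp add: x_def)
    also have "\<dots> \<le> real (card F) * (17 / 32) ^ Suc n" using Suc by simp
    finally show ?case .
  qed (simp add: cs0)
  \<comment> \<open>Since \<open>8 * (17 / 32) ^ 4 < 1\<close>, a large power absorbs the factor
    \<open>card F\<close> in the bound on the total weight. The successor taken below makes
    \<open>M\<close> positive.\<close>
  obtain M0 where M0: "(8 * (17 / 32) ^ 4) ^ M0 < 1 / real (card F)"
    using real_arch_pow_inv[of "1 / real (card F)" "8 * (17 / 32) ^ 4"] F
    by (auto simp: card_gt_0_iff power_divide)
  define M where "M = Suc M0"
  have "(8 * (17 / 32) ^ 4 :: real) ^ M \<le> (8 * (17 / 32) ^ 4) ^ M0"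
    unfolding M_def by (intro power_decreasing) (auto simp: power_divide)
  with M0 have "(8 * (17 / 32) ^ 4) ^ M \<le> 1 / real (card F)" by linarith
  have M: "real (card F) * (17 / 32) ^ (4 * M) \<le> (1 / 8) ^ M"
  proof -
    have "c * a \<le> 1 / b" if "b * a \<le> 1 / c" "0 < b" "0 < c" for a b c :: real
      using that by (simp add: field_simps)
    from this[of "8 ^ M" "(17 / 32) ^ (4 * M)" "real (card F)"] F show ?thesis
      using \<open>(8 * (17 / 32) ^ 4) ^ M \<le> 1 / real (card F)\<close>
      by (simp only: power_mult_distrib power_mult power_one_over) (simp add: card_gt_0_iff)
  qed
  \<comment> \<open>A single weight is at most the total, which is at most
    \<open>(1 / 8) ^ M = (1 / 2) ^ (3 * M)\<close>; comparing exponents bounds the count.\<close>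
  have "3 * M \<le> cs (4 * M) f" if "f \<in> F" for f
  proof -
    have "?w (cs (4 * M)) f \<le> sum (?w (cs (4 * M))) F"
      using that F by (intro member_le_sum) auto
    also have "\<dots> \<le> (1 / 8) ^ M" using pot[of "4 * M"] M by linarith
    also have "\<dots> = (1 / 2 :: real) ^ (3 * M)" by (simp add: power_mult power_divide)
    finally show ?thesis by (subst (asm) power_decreasing_iff) auto
  qed
  then show ?thesis using ne cs by (intro exI[of _ M] exI[of _ x]) (auto simp: M_def)
qed

text \<open>The points \<open>x i\<close> which fail to bring a given \<open>f\<close> near \<open>C\<close> still bring it within
  \<open>2 * r + r / 4\<close> of \<open>C\<close>, because they succeed for some other point of \<open>F\<close>. As at most a
  quarter of them fails, averaging gives the error \<open>r / 4 + 2 * r / 4 < r\<close>.\<close>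

lemma bounded_loose_radius_ge_quarter:
  fixes C :: "'a::banach set"
  assumes C: "C \<in> cbc_sets" and r: "0 < r"
    and cover: "\<And>F (w :: 'a \<Rightarrow> real). finite F \<Longrightarrow> F \<subseteq> cball 0 r \<Longrightarrow> F \<noteq> {} \<Longrightarrow> (\<And>f. f \<in> F \<Longrightarrow> 0 < w f) \<Longrightarrow>
      \<exists>x. 15 / 16 * sum w F \<le> sum w {f\<in>F. \<exists>c\<in>C. norm (f + x - c) \<le> r / 4}"
  shows "ennreal (r / 4) \<le> bounded_loose_radius C"
proof -
  obtain R where R: "0 < R" "\<And>c. c \<in> C \<Longrightarrow> norm c \<le> R"
    using C by (auto simp: cbc_sets_def bounded_pos)
  \<comment> \<open>This radius contains every useful \<open>x i\<close>: one that brings a point of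
    \<open>F\<close> within \<open>r / 4\<close> of \<open>C\<close> has norm at most
    \<open>r / 4 + R + r\<close>.\<close>
  define \<rho> where "\<rho> = R + 2 * r"
  have "\<exists>z\<in>cball 0 \<rho>. \<forall>f\<in>F. \<exists>d\<in>C. norm (f + z - d) \<le> 3 * r / 4"
    if F: "finite F" "F \<subseteq> cball 0 r" for F
  proof (cases "F = {}")
    case True
    then show ?thesis using R(1) r by (intro bexI[of _ 0]) (auto simp: \<rho>_def)
  next
    case False
    have nF: "norm g \<le> r" if "g \<in> F" for g using F(2) that by auto
    define A where "A = (\<lambda>x. {f. \<exists>c\<in>C. norm (f + x - c) \<le> r / 4})"
    have "\<exists>x. 15 / 16 * sum w F \<le> sum w (F \<inter> A x)" if "\<And>f. f \<in> F \<Longrightarrow> 0 < w f" for w :: "'a \<Rightarrow> real"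
      using cover[OF F False that] by (simp add: A_def Collect_conj_eq)
    from balanced_sequence_of_covering_sets[OF F(1) False this] obtain M x where M: "0 < M"
      and ne: "\<And>i :: nat. F \<inter> A (x i) \<noteq> {}"
      and cnt: "\<And>f. f \<in> F \<Longrightarrow> 3 * M \<le> card {i\<in>{..<4 * M}. f \<in> A (x i)}"
      by auto
    define N where "N = 4 * M"
    have N: "0 < N" using M by (simp add: N_def)
    define z where "z = (1 / real N) *\<^sub>R (\<Sum>i<N. x i)"
    have near: "\<exists>g c. g \<in> F \<and> c \<in> C \<and> norm (g + x i - c) \<le> r / 4" for i
      using ne[of i] unfolding A_def by blast
    have "norm (x i) \<le> \<rho>" for i
    proof -
      obtain g c where gc: "g \<in> F" "c \<in> C" "norm (g + x i - c) \<le> r / 4" using near by blast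
      have "norm (x i) = norm ((g + x i - c) + (c - g))"
        by (rule arg_cong[of _ _ norm]) simp
      also have "\<dots> \<le> r / 4 + (R + r)"
        using gc nF[of g] R(2)[of c] norm_triangle_ineq4[of c g]
        by (intro norm_triangle_le) linarith
      finally show ?thesis using r by (simp add: \<rho>_def)
    qed
    then have "norm (\<Sum>i<N. x i) \<le> real N * \<rho>"
      using sum_norm_le[of "{..<N}" x "\<lambda>_. \<rho>"] by simp
    then have "norm z \<le> \<rho>" using N by (simp add: z_def field_simps)
    moreover have "\<exists>d\<in>C. norm (f + z - d) \<le> 3 * r / 4" if f: "f \<in> F" for f
    proof -
      have "\<exists>c\<in>C. norm (f + x i - c) \<le> r / 4 + (if f \<in> A (x i) then 0 else 2 * r)" for i
      proof (cases "f \<in> A (x i)")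
        case True
        then show ?thesis by (auto simp: A_def)
      next
        case False
        obtain g c where gc: "g \<in> F" "c \<in> C" "norm (g + x i - c) \<le> r / 4" using near by blast
        have "norm (f + x i - c) = norm ((g + x i - c) + (f - g))"
          by (rule arg_cong[of _ _ norm]) simp
        also have "\<dots> \<le> r / 4 + 2 * r"
          using gc nF[of f] nF[of g] f norm_triangle_ineq4[of f g]
          by (intro norm_triangle_le) linarith
        finally show ?thesis using gc False by auto
      qed
      then obtain c where c: "\<And>i. c i \<in> C"
          "\<And>i. norm (f + x i - c i) \<le> r / 4 + (if f \<in> A (x i) then 0 else 2 * r)"
        by metis
      define d where "d = (\<Sum>i<N. (1 / real N) *\<^sub>R c i)"
      have "d \<in> C"
        unfolding d_def using C c N by (intro convex_sum) (auto simp: cbc_sets_def)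
      \<comment> \<open>Writing \<open>f\<close> as an average of copies of itself turns
        \<open>f + z - d\<close> into the average of the individual errors.\<close>
      have "f = (1 / real N) *\<^sub>R (\<Sum>i<N. f)" using N by (simp add: sum_constant_scaleR)
      then have "f + z - d = (1 / real N) *\<^sub>R (\<Sum>i<N. f) + z - d" by simp
      also have "\<dots> = (1 / real N) *\<^sub>R (\<Sum>i<N. f + x i - c i)"
        by (simp only: z_def d_def sum_subtractf sum.distrib scaleR_add_right scaleR_diff_right
              scaleR_sum_right)
      finally have "norm (f + z - d) = norm (\<Sum>i<N. f + x i - c i) / real N" by simp
      moreover have "norm (\<Sum>i<N. f + x i - c i)
          \<le> (\<Sum>i<N. r / 4 + (if f \<in> A (x i) then 0 else 2 * r))"
        by (rule sum_norm_le) (rule c)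
      moreover have "(\<Sum>i<N. r / 4 + (if f \<in> A (x i) then 0 else 2 * r))
          = real N * (r / 4) + real (card {i\<in>{..<N}. f \<notin> A (x i)}) * (2 * r)"
        by (simp add: sum.distrib sum.If_cases Int_def)
      moreover have "card {i\<in>{..<N}. f \<in> A (x i)} + card {i\<in>{..<N}. f \<notin> A (x i)} = N"
      proof -
        have "{i\<in>{..<N}. f \<in> A (x i)} \<union> {i\<in>{..<N}. f \<notin> A (x i)} = {..<N}" by auto
        then show ?thesis by (subst card_Un_disjoint[symmetric]) auto
      qed
      then have "4 * card {i\<in>{..<N}. f \<notin> A (x i)} \<le> N"
        using cnt[OF f] by (simp add: N_def)
      then have "4 * real (card {i\<in>{..<N}. f \<notin> A (x i)}) * (r / 2) \<le> real N * (r / 2)"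
        using r by (intro mult_right_mono) (auto simp flip: of_nat_le_iff)
      ultimately have "norm (f + z - d) * real N \<le> real N * (3 * r / 4)"
        using N by (simp add: algebra_simps)
      then have "norm (f + z - d) \<le> 3 * r / 4" using N by (simp add: mult.commute)
      with \<open>d \<in> C\<close> show ?thesis by blast
    qed
    ultimately show ?thesis by (intro bexI[of _ z]) auto
  qed
  then have "ennreal (r - 3 * r / 4) \<le> loose_radius C \<rho>"
    using r by (intro loose_radius_ge[OF C]) auto
  moreover have "r - 3 * r / 4 = r / 4" by simp
  ultimately have "ennreal (r / 4) \<le> loose_radius C \<rho>" by (simp only:)
  also have "\<dots> \<le> bounded_loose_radius C"
    using R(1) r by (intro loose_radius_le_bounded_loose_radius) (simp add: \<rho>_def)
  finally show ?thesis .
qed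

text \<open>Contraposition of \<open>bounded_loose_radius_ge_quarter\<close>: with radius 0, some
  positive weights on a finite set admit no good translation. Dividing by their total makes them a
  probability.\<close>

lemma escaping_weights:
  fixes C :: "'a::banach set"
  assumes C: "C \<in> cbc_sets" "bounded_loose_radius C = 0" and r: "0 < r"
  shows "\<exists>F (w :: 'a \<Rightarrow> real). finite F \<and> F \<subseteq> cball 0 r \<and> (\<forall>f\<in>F. 0 \<le> w f) \<and> sum w F = 1 \<and>
           (\<forall>x. sum w {f\<in>F. \<exists>c\<in>C. norm (f + x - c) \<le> r / 4} \<le> 15 / 16)"
proof -
  have "\<not> (\<forall>F (w :: 'a \<Rightarrow> real). finite F \<longrightarrow> F \<subseteq> cball 0 r \<longrightarrow> F \<noteq> {} \<longrightarrow> (\<forall>f\<in>F. 0 < w f) \<longrightarrow>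
      (\<exists>x. 15 / 16 * sum w F \<le> sum w {f\<in>F. \<exists>c\<in>C. norm (f + x - c) \<le> r / 4}))" (is "\<not> ?cover")
  proof
    assume ?cover
    then have "ennreal (r / 4) \<le> bounded_loose_radius C"
      by (intro bounded_loose_radius_ge_quarter[OF C(1) r]) blast
    with C(2) r show False by simp
  qed
  then obtain F :: "'a set" and w :: "'a \<Rightarrow> real"
    where F: "finite F" "F \<subseteq> cball 0 r" "F \<noteq> {}" and w: "\<forall>f\<in>F. 0 < w f"
      and "\<not> (\<exists>x. 15 / 16 * sum w F \<le> sum w {f\<in>F. \<exists>c\<in>C. norm (f + x - c) \<le> r / 4})"
    unfolding not_all not_imp by (elim exE conjE)
  then have le: "sum w {f\<in>F. \<exists>c\<in>C. norm (f + x - c) \<le> r / 4} \<le> 15 / 16 * sum w F" for x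
    by (meson linear)
  have "0 < sum w F" using F w by (intro sum_pos) auto
  then show ?thesis
    using F w le
    by (intro exI[of _ F] exI[of _ "\<lambda>f. w f / sum w F"])
       (simp add: less_imp_le pos_divide_le_eq flip: sum_divide_distrib)
qed

section \<open>Random series\<close>

text \<open>An element of \<open>T'\<close> consists of a prefix in \<open>T\<close> and a last
  entry in a set of weight at most \<open>q\<close> that depends on the prefix. Summing over the
  last entry first produces the factor \<open>q\<close>.\<close>

lemma sum_prod_PiE_Suc_le:
  fixes w :: "nat \<Rightarrow> 'b \<Rightarrow> real"
  assumes F: "\<And>n. finite (F n)" and w: "\<And>n f. f \<in> F n \<Longrightarrow> 0 \<le> w n f"
    and T: "T \<subseteq> (\<Pi>\<^sub>E k\<in>{..<n}. F k)" and T': "T' \<subseteq> (\<Pi>\<^sub>E k\<in>{..<Suc n}. F k)"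
    and sub: "\<And>u i. u \<in> (\<Pi>\<^sub>E k\<in>{..<n}. F k) \<Longrightarrow> i \<in> F n \<Longrightarrow> u(n := i) \<in> T' \<Longrightarrow> u \<in> T \<and> i \<in> G u"
    and G: "\<And>u. u \<in> T \<Longrightarrow> sum (w n) (F n \<inter> G u) \<le> q"
  shows "(\<Sum>u\<in>T'. \<Prod>k<Suc n. w k (u k)) \<le> q * (\<Sum>u\<in>T. \<Prod>k<n. w k (u k))"
proof -
  define S where "S = (SIGMA u:T. F n \<inter> G u)"
  have finT: "finite T" by (rule finite_subset[OF T]) (intro finite_PiE finite_lessThan F)
  have upd: "(\<Prod>k<Suc n. w k ((u(n := i)) k)) = (\<Prod>k<n. w k (u k)) * w n i" for u i
  proof -
    have "(\<Prod>k<n. w k ((u(n := i)) k)) = (\<Prod>k<n. w k (u k))" by (rule prod.cong) auto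
    then show ?thesis by simp
  qed
  have nn: "0 \<le> (\<Prod>k<n. w k (u k))" if "u \<in> T" for u
    using that T w by (intro prod_nonneg) (auto simp: PiE_iff subset_iff)
  have "T' \<subseteq> (\<lambda>(u, i). u(n := i)) ` S"
  proof
    fix v assume v: "v \<in> T'"
    then have "v \<in> (\<Pi>\<^sub>E k\<in>{..<Suc n}. F k)" using T' by blast
    then obtain u i where u: "u \<in> (\<Pi>\<^sub>E k\<in>{..<n}. F k)" "i \<in> F n" "v = u(n := i)"
      by (intro that[of "v(n := undefined)" "v n"]) (auto simp: PiE_iff extensional_def)
    then have "u \<in> T \<and> i \<in> G u" using sub[of u i] v by simp
    then show "v \<in> (\<lambda>(u, i). u(n := i)) ` S"
      unfolding S_def u(3) using u(2) by (intro image_eqI[of _ _ "(u, i)"]) auto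
  qed
  moreover have finS: "finite S" unfolding S_def using finT F by auto
  ultimately have "(\<Sum>u\<in>T'. \<Prod>k<Suc n. w k (u k)) \<le> (\<Sum>v\<in>(\<lambda>(u, i). u(n := i)) ` S. \<Prod>k<Suc n. w k (v k))"
  proof (intro sum_mono2)
    fix v assume "v \<in> (\<lambda>(u, i). u(n := i)) ` S - T'"
    then obtain u i where "u \<in> T" "i \<in> F n" "v = u(n := i)" unfolding S_def by auto
    then show "0 \<le> (\<Prod>k<Suc n. w k (v k))" using nn w by (simp only: upd) simp
  qed auto
  also have "\<dots> \<le> (\<Sum>p\<in>S. \<Prod>k<Suc n. w k (((fst p)(n := snd p)) k))"
  proof (rule order_trans[OF sum_image_le[OF finS]])
    fix p assume "p \<in> S"
    then show "0 \<le> (\<Prod>k<Suc n. w k ((case p of (u, i) \<Rightarrow> u(n := i)) k))"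
      unfolding case_prod_unfold upd using nn w by (auto simp: S_def)
  qed (simp only: comp_def case_prod_unfold order_refl)
  also have "\<dots> = (\<Sum>u\<in>T. (\<Prod>k<n. w k (u k)) * sum (w n) (F n \<inter> G u))"
    unfolding S_def upd using finT F
    by (simp add: sum.Sigma sum_distrib_left case_prod_unfold)
  also have "\<dots> \<le> (\<Sum>u\<in>T. (\<Prod>k<n. w k (u k)) * q)"
    by (intro sum_mono mult_left_mono G nn)
  also have "\<dots> = q * (\<Sum>u\<in>T. \<Prod>k<n. w k (u k))" by (simp add: sum_distrib_left mult.commute)
  finally show ?thesis .
qed

text \<open>The sum of the first \<open>n\<close> variables can come within \<open>2 / 8 ^ n\<close> of \<open>C\<close> only if at every
  step \<open>k < n\<close> the variable \<open>k\<close>, which is bounded by \<open>1 / 8 ^ k\<close>, hits a set of weight at most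
  \<open>15/16\<close> determined by the previous ones.\<close>

lemma prefix_weight_le:
  fixes C :: "'a::real_normed_vector set" and w :: "nat \<Rightarrow> 'a \<Rightarrow> real"
  assumes F: "\<And>n. finite (F n)" "\<And>n. F n \<subseteq> cball 0 ((1 / 8) ^ n)"
    and w: "\<And>n f. f \<in> F n \<Longrightarrow> 0 \<le> w n f"
    and esc: "\<And>n x. sum (w n) {f\<in>F n. \<exists>c\<in>C. norm (f + x - c) \<le> (1 / 8) ^ n / 4} \<le> 15 / 16"
  shows "(\<Sum>u\<in>{u\<in>\<Pi>\<^sub>E k\<in>{..<n}. F k. \<exists>c\<in>C. norm ((\<Sum>k<n. u k) + x - c) \<le> 2 * (1 / 8) ^ n}.
            \<Prod>k<n. w k (u k)) \<le> (15 / 16) ^ n"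
proof (induction n)
  case 0
  let ?T = "{u\<in>\<Pi>\<^sub>E k\<in>{..<0}. F k. \<exists>c\<in>C. norm ((\<Sum>k<0. u k) + x - c) \<le> 2 * (1 / 8) ^ 0}"
  have "?T \<subseteq> {\<lambda>_. undefined}" by auto
  then have "card ?T \<le> card {\<lambda>_ :: nat. undefined :: 'a}" by (intro card_mono) auto
  moreover have "(\<Sum>u\<in>?T. \<Prod>k<0. w k (u k)) = real (card ?T)" by simp
  ultimately show ?case by simp
next
  case (Suc n)
  let ?T = "\<lambda>n. {u\<in>\<Pi>\<^sub>E k\<in>{..<n}. F k. \<exists>c\<in>C. norm ((\<Sum>k<n. u k) + x - c) \<le> 2 * (1 / 8) ^ n}"
  let ?G = "\<lambda>u. {i. \<exists>c\<in>C. norm (i + ((\<Sum>k<n. u k) + x) - c) \<le> (1 / 8) ^ n / 4}"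
  have "(\<Sum>u\<in>?T (Suc n). \<Prod>k<Suc n. w k (u k)) \<le> 15 / 16 * (\<Sum>u\<in>?T n. \<Prod>k<n. w k (u k))"
  proof (rule sum_prod_PiE_Suc_le[where F = F and G = ?G])
    fix u i assume u: "u \<in> (\<Pi>\<^sub>E k\<in>{..<n}. F k)" and i: "i \<in> F n" and "u(n := i) \<in> ?T (Suc n)"
    then obtain c where c: "c \<in> C"
        "norm ((\<Sum>k<Suc n. (u(n := i)) k) + x - c) \<le> 2 * (1 / 8) ^ Suc n" by blast
    have eq: "(\<Sum>k<Suc n. (u(n := i)) k) = (\<Sum>k<n. u k) + i" by simp
    have le: "norm ((\<Sum>k<n. u k) + i + x - c) \<le> (1 / 8) ^ n / 4"
      using c(2) unfolding eq by simp
    have "norm i \<le> (1 / 8) ^ n" using i F(2)[of n] by auto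
    moreover have "norm ((\<Sum>k<n. u k) + x - c) \<le> norm ((\<Sum>k<n. u k) + i + x - c) + norm i"
      using norm_triangle_ineq4[of "(\<Sum>k<n. u k) + i + x - c" i] by (simp add: algebra_simps)
    moreover have "0 \<le> (1 / 8 :: real) ^ n" by simp
    \<comment> \<open>The ratio \<open>1 / 8\<close> makes \<open>2 * (1 / 8) ^ Suc n\<close> equal
      to \<open>(1 / 8) ^ n / 4\<close>, the threshold in \<open>esc\<close>; adding
      \<open>norm i\<close> still leaves less than \<open>2 * (1 / 8) ^ n\<close>.\<close>
    ultimately have "norm ((\<Sum>k<n. u k) + x - c) \<le> 2 * (1 / 8) ^ n" using le by linarith
    moreover have "norm (i + ((\<Sum>k<n. u k) + x) - c) \<le> (1 / 8) ^ n / 4"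
      using le by (simp add: algebra_simps)
    ultimately show "u \<in> ?T n \<and> i \<in> ?G u" using u c(1) by blast
  next
    show "sum (w n) (F n \<inter> ?G u) \<le> 15 / 16" for u
      using esc[of n "(\<Sum>k<n. u k) + x"] by (simp add: Collect_conj_eq)
  qed (use F w in auto)
  also have "\<dots> \<le> 15 / 16 * (15 / 16) ^ n" by (intro mult_left_mono Suc.IH) simp
  finally show ?case by simp
qed

text \<open>The witness is the law of the series of the coordinates under the product measure. If
  the series lands in \<open>x + C\<close>, then every partial sum, shifted by \<open>- x\<close>,
  is as close to \<open>C\<close> as \<open>prefix_weight_le\<close> asks, so the event has
  probability at most \<open>(15 / 16) ^ n\<close> for every \<open>n\<close>.\<close>

lemma haar_null_if_escaping_weights:
  fixes C :: "'a::banach set" and F :: "nat \<Rightarrow> 'a set" and w :: "nat \<Rightarrow> 'a \<Rightarrow> real"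
  assumes C: "closed C"
    and F: "\<And>n. finite (F n)" "\<And>n. F n \<subseteq> cball 0 ((1 / 8) ^ n)"
    and w: "\<And>n f. f \<in> F n \<Longrightarrow> 0 \<le> w n f" "\<And>n. sum (w n) (F n) = 1"
    and esc: "\<And>n x. sum (w n) {f\<in>F n. \<exists>c\<in>C. norm (f + x - c) \<le> (1 / 8) ^ n / 4} \<le> 15 / 16"
  shows "haar_null C"
proof -
  define M where "M = (\<lambda>n. point_measure (F n) (\<lambda>f. ennreal (w n f)))"
  have space_M: "space (M n) = F n" and sets_M: "sets (M n) = Pow (F n)" for n
    by (simp_all add: M_def space_point_measure sets_point_measure)
  have M: "prob_space (M n)" for n
    unfolding M_def using F w by (intro prob_space_point_measure) auto
  have emM: "emeasure (M n) {f} = ennreal (w n f)" if "f \<in> F n" for n f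
    using that F by (simp add: M_def emeasure_point_measure_finite)
  interpret product_prob_space M UNIV
    using M by (intro product_prob_spaceI)
  let ?\<Omega> = "PiM UNIV M"
  have coord: "\<omega> n \<in> F n" if "\<omega> \<in> space ?\<Omega>" for \<omega> n
    using that by (auto simp: space_PiM space_M PiE_iff)
  have small: "norm (\<omega> n) \<le> (1 / 8) ^ n" if "\<omega> \<in> space ?\<Omega>" for \<omega> n
    using coord[OF that, of n] F(2)[of n] by auto
  have geo: "summable (\<lambda>n. (1 / 8 :: real) ^ n)" by (simp add: summable_geometric)
  have smb: "summable \<omega>" if "\<omega> \<in> space ?\<Omega>" for \<omega>
    by (rule summable_comparison_test'[OF geo small[OF that]])
  have tail: "norm ((\<Sum>n. \<omega> n) - (\<Sum>k<n. \<omega> k)) \<le> 2 * (1 / 8) ^ n" if "\<omega> \<in> space ?\<Omega>" for \<omega> n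
  proof -
    have "(\<Sum>n. \<omega> n) - (\<Sum>k<n. \<omega> k) = (\<Sum>k. \<omega> (k + n))"
      using suminf_split_initial_segment[OF smb[OF that], of n] by simp
    also have "norm \<dots> \<le> (\<Sum>k. (1 / 8) ^ (k + n))"
      by (rule norm_suminf_le[OF small[OF that]]) (use geo in \<open>simp add: summable_iff_shift\<close>)
    also have "\<dots> = 8 / 7 * (1 / 8) ^ n"
      using suminf_mult2[OF geo, of "(1 / 8) ^ n"] suminf_geometric[of "1 / 8 :: real"]
      by (simp add: power_add)
    also have "\<dots> \<le> 2 * (1 / 8) ^ n" by (intro mult_right_mono) auto
    finally show ?thesis .
  qed
  \<comment> \<open>Measurability into the discrete space is obtained by splitting over the finitely
    many values of the new coordinate, which bypasses Borel measurability of addition on a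
    product.\<close>
  have meas_sum: "(\<lambda>\<omega>. \<Sum>k<n. \<omega> k) \<in> ?\<Omega> \<rightarrow>\<^sub>M count_space UNIV" for n
  proof (induction n)
    case (Suc n)
    have "(\<lambda>\<omega>. \<omega> n) \<in> ?\<Omega> \<rightarrow>\<^sub>M count_space (F n)"
      using measurable_component_singleton[of n UNIV M]
      by (simp add: measurable_def space_M sets_M)
    moreover have "(\<lambda>\<omega>. (\<Sum>k<n. \<omega> k) + i) \<in> ?\<Omega> \<rightarrow>\<^sub>M count_space UNIV" for i
      using measurable_compose[OF Suc.IH, of "\<lambda>s. s + i" "count_space UNIV"] by simp
    ultimately show ?case
      using measurable_compose_countable'[of "F n" "\<lambda>i \<omega>. (\<Sum>k<n. \<omega> k) + i" ?\<Omega> "count_space UNIV" "\<lambda>\<omega>. \<omega> n"]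
        F(1)[of n] by (simp add: countable_finite)
  qed simp
  have meas: "(\<lambda>\<omega>. \<Sum>n. \<omega> n) \<in> borel_measurable ?\<Omega>"
  proof (rule borel_measurable_LIMSEQ_metric)
    show "(\<lambda>\<omega>. \<Sum>k<n. \<omega> k) \<in> borel_measurable ?\<Omega>" for n
      using measurable_compose[OF meas_sum, of "\<lambda>s. s" borel] by simp
    show "(\<lambda>n. \<Sum>k<n. \<omega> k) \<longlonglongrightarrow> (\<Sum>n. \<omega> n)" if "\<omega> \<in> space ?\<Omega>" for \<omega>
      using summable_LIMSEQ[OF smb[OF that]] .
  qed
  define \<mu> where "\<mu> = distr ?\<Omega> borel (\<lambda>\<omega>. \<Sum>n. \<omega> n)"
  have "prob_space \<mu>" unfolding \<mu>_def by (rule prob_space_distr[OF meas])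
  moreover have "emeasure \<mu> ((\<lambda>e. x + e) ` C) = 0" for x
  proof -
    have cl: "closed ((\<lambda>e. x + e) ` C)" using C by (rule closed_translation)
    define E where "E = (\<lambda>\<omega>. \<Sum>n. \<omega> n) -` (\<lambda>e. x + e) ` C \<inter> space ?\<Omega>"
    have E: "emeasure \<mu> ((\<lambda>e. x + e) ` C) = emeasure ?\<Omega> E"
      unfolding \<mu>_def E_def using cl by (intro emeasure_distr meas) auto
    have "emeasure ?\<Omega> E \<le> ennreal ((15 / 16) ^ n)" for n
    proof -
      define T where "T = {u\<in>\<Pi>\<^sub>E k\<in>{..<n}. F k. \<exists>c\<in>C. norm ((\<Sum>k<n. u k) + - x - c) \<le> 2 * (1 / 8) ^ n}"
      \<comment> \<open>As the coordinates take finitely many values, the event is covered by the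
        finitely many cylinders of admissible prefixes, whose probabilities are products of
        weights.\<close>
      define cyl where "cyl = (\<lambda>u. {\<omega>\<in>space ?\<Omega>. \<forall>k\<in>{..<n}. \<omega> k \<in> {u k}})"
      have finT: "finite T"
        by (rule finite_subset[of _ "\<Pi>\<^sub>E k\<in>{..<n}. F k"]) (auto simp: T_def intro!: finite_PiE F)
      have TF: "u k \<in> F k" if "u \<in> T" "k < n" for u k
        using that by (auto simp: T_def PiE_iff)
      have "E \<subseteq> (\<Union>u\<in>T. cyl u)"
      proof
        fix \<omega> assume "\<omega> \<in> E"
        then obtain c where \<omega>: "\<omega> \<in> space ?\<Omega>" and c: "c \<in> C" "(\<Sum>n. \<omega> n) = x + c"
          unfolding E_def by auto
        define u where "u = restrict \<omega> {..<n}"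
        have "(\<Sum>k<n. u k) = (\<Sum>k<n. \<omega> k)" by (rule sum.cong) (auto simp: u_def)
        then have "norm ((\<Sum>k<n. u k) + - x - c) = norm ((\<Sum>n. \<omega> n) - (\<Sum>k<n. \<omega> k))"
          using c(2) by (subst norm_minus_commute) (simp add: algebra_simps)
        then have "norm ((\<Sum>k<n. u k) + - x - c) \<le> 2 * (1 / 8) ^ n" using tail[OF \<omega>, of n] by simp
        moreover have "u \<in> (\<Pi>\<^sub>E k\<in>{..<n}. F k)" using coord[OF \<omega>] by (auto simp: u_def)
        ultimately have "u \<in> T" unfolding T_def using c(1) by blast
        moreover have "\<omega> \<in> cyl u" unfolding cyl_def u_def using \<omega> by simp
        ultimately show "\<omega> \<in> (\<Union>u\<in>T. cyl u)" by blast
      qed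
      moreover have cyl_sets: "cyl u \<in> sets ?\<Omega>" if "u \<in> T" for u
        unfolding cyl_def using TF[OF that]
        by (intro sets.sets_Collect_finite_All sets_Collect_single) (auto simp: sets_M)
      ultimately have "emeasure ?\<Omega> E \<le> emeasure ?\<Omega> (\<Union>u\<in>T. cyl u)"
        using finT by (intro emeasure_mono) auto
      also have "\<dots> \<le> (\<Sum>u\<in>T. emeasure ?\<Omega> (cyl u))"
        using cyl_sets by (intro emeasure_subadditive_finite finT) auto
      also have "\<dots> = (\<Sum>u\<in>T. ennreal (\<Prod>k<n. w k (u k)))"
      proof (rule sum.cong[OF refl])
        fix u assume u: "u \<in> T"
        have "emeasure ?\<Omega> (cyl u) = (\<Prod>k<n. emeasure (M k) {u k})"
          unfolding cyl_def using TF[OF u] by (intro emeasure_PiM_Collect) (auto simp: sets_M)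
        also have "\<dots> = (\<Prod>k<n. ennreal (w k (u k)))"
          using TF[OF u] by (intro prod.cong) (auto simp: emM)
        also have "\<dots> = ennreal (\<Prod>k<n. w k (u k))"
          using TF[OF u] w(1) by (intro prod_ennreal) auto
        finally show "emeasure ?\<Omega> (cyl u) = ennreal (\<Prod>k<n. w k (u k))" .
      qed
      also have "\<dots> = ennreal (\<Sum>u\<in>T. \<Prod>k<n. w k (u k))"
        using TF w(1) by (intro sum_ennreal prod_nonneg) auto
      also have "\<dots> \<le> ennreal ((15 / 16) ^ n)"
        unfolding T_def by (intro ennreal_leI prefix_weight_le F w(1) esc)
      finally show ?thesis .
    qed
    moreover have "(\<lambda>n. ennreal ((15 / 16) ^ n)) \<longlonglongrightarrow> ennreal 0"
      by (intro tendsto_ennrealI LIMSEQ_realpow_zero) auto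
    ultimately have "emeasure ?\<Omega> E \<le> ennreal 0"
      using LIMSEQ_le_const by blast
    then show ?thesis unfolding E by simp
  qed
  ultimately show ?thesis
    unfolding haar_null_def using C by (intro conjI exI[of _ \<mu>]) (auto simp: \<mu>_def)
qed

lemma haar_null_if_bounded_loose_radius_zero:
  fixes C :: "'a::banach set"
  assumes C: "C \<in> cbc_sets" "bounded_loose_radius C = 0"
  shows "haar_null C"
proof -
  have "\<forall>n. \<exists>F (w :: 'a \<Rightarrow> real). finite F \<and> F \<subseteq> cball 0 ((1 / 8) ^ n) \<and> (\<forall>f\<in>F. 0 \<le> w f) \<and> sum w F = 1 \<and>
      (\<forall>x. sum w {f\<in>F. \<exists>c\<in>C. norm (f + x - c) \<le> (1 / 8) ^ n / 4} \<le> 15 / 16)"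
    using escaping_weights[OF C] by simp
  then obtain F and w :: "nat \<Rightarrow> 'a \<Rightarrow> real" where "\<forall>n. finite (F n) \<and> F n \<subseteq> cball 0 ((1 / 8) ^ n) \<and>
      (\<forall>f\<in>F n. 0 \<le> w n f) \<and> sum (w n) (F n) = 1 \<and>
      (\<forall>x. sum (w n) {f\<in>F n. \<exists>c\<in>C. norm (f + x - c) \<le> (1 / 8) ^ n / 4} \<le> 15 / 16)"
    by (elim choice[elim_format] exE)
  then show ?thesis
    using C(1) by (intro haar_null_if_escaping_weights[of C F w]) (auto simp: cbc_sets_def)
qed

section \<open>Openness of the Haar positive sets\<close>

lemma haar_null_iff_bounded_loose_radius_zero:
  fixes C :: "'a::banach set"
  assumes "separable_space (euclidean :: 'a topology)" "C \<in> cbc_sets"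
  shows "haar_null C \<longleftrightarrow> bounded_loose_radius C = 0"
  using not_haar_null_if_bounded_loose_radius_pos[OF assms]
    haar_null_if_bounded_loose_radius_zero[OF assms(2)] by (auto simp: zero_less_iff_neq_zero)

lemma haar_positive_cbc_eq:
  assumes "separable_space (euclidean :: 'a::banach topology)"
  shows "(haar_positive_cbc :: 'a set set) = {C \<in> cbc_sets. 0 < bounded_loose_radius C}"
proof -
  have "C \<in> sets borel" if "C \<in> cbc_sets" for C :: "'a set"
    using that by (simp add: cbc_sets_def borel_closed)
  then show ?thesis
    unfolding haar_positive_cbc_def haar_positive_def
    by (intro Collect_cong)
       (metis haar_null_iff_bounded_loose_radius_zero[OF assms] zero_less_iff_neq_zero)
qed

text \<open>Haar positivity means positive radius, and \<open>bounded_loose_radius_le_add\<close>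
  keeps the radius positive at all distances below a \<open>\<delta>\<close> smaller than the radius
  of \<open>C\<close>.\<close>

lemma openin_haar_positive_cbc:
  assumes "separable_space (euclidean :: 'a::banach topology)"
  shows "openin (mtopology_of hausdorff_metric) (haar_positive_cbc :: 'a set set)"
proof -
  have "\<exists>\<delta>>0. \<forall>D\<in>cbc_sets. hausdorff_dist C D < \<delta> \<longrightarrow> 0 < bounded_loose_radius D"
    if C: "C \<in> cbc_sets" "0 < bounded_loose_radius C" for C :: "'a set"
  proof -
    \<comment> \<open>An intermediate value is finite even if the radius of \<open>C\<close> is
      infinite, and so gives a real \<open>\<delta>\<close>.\<close>
    obtain b where "0 < b" "b < bounded_loose_radius C" using dense[OF C(2)] by blast
    then obtain \<delta> where \<delta>: "0 < \<delta>" "ennreal \<delta> < bounded_loose_radius C"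
      by (cases b) auto
    have "0 < bounded_loose_radius D" if D: "D \<in> cbc_sets" "hausdorff_dist C D < \<delta>" for D
      using bounded_loose_radius_le_add[OF C(1) D] \<delta>(2)
      by (cases "bounded_loose_radius D = 0") (auto simp: zero_less_iff_neq_zero)
    with \<delta>(1) show ?thesis by blast
  qed
  note radius_pos = this
  interpret H: Metric_space "mspace (hausdorff_metric :: 'a set metric)" "mdist hausdorff_metric"
    by (rule Metric_space_mspace_mdist)
  show ?thesis
    unfolding haar_positive_cbc_eq[OF assms] mtopology_of_def H.openin_mtopology
  proof (intro conjI allI impI)
    show "{C :: 'a set. C \<in> cbc_sets \<and> 0 < bounded_loose_radius C} \<subseteq> mspace hausdorff_metric"
      by (auto simp: mspace_hausdorff_metric)
    fix C :: "'a set" assume "C \<in> {C \<in> cbc_sets. 0 < bounded_loose_radius C}"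
    then obtain \<delta> where C: "C \<in> cbc_sets" and \<delta>: "0 < \<delta>"
        "\<forall>D\<in>cbc_sets. hausdorff_dist C D < \<delta> \<longrightarrow> 0 < bounded_loose_radius D"
      using radius_pos[of C] by blast
    have "D \<in> cbc_sets \<and> 0 < bounded_loose_radius D" if D: "D \<in> H.mball C \<delta>" for D
    proof -
      have "D \<in> cbc_sets" "mdist hausdorff_metric C D < \<delta>"
        using D[unfolded H.in_mball] by (simp_all add: mspace_hausdorff_metric)
      with \<delta>(2) show ?thesis by (simp add: mdist_hausdorff_metric[OF C])
    qed
    with \<delta>(1) show "\<exists>r>0. H.mball C r \<subseteq> {C \<in> cbc_sets. 0 < bounded_loose_radius C}" by blast
  qed
qed

text \<open>The finiteness clause shows that \<open>enn2real\<close> loses nothing on a nonzero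
  space. On the zero space the only carrier set has infinite radius, and both sides of the Lipschitz
  estimate vanish.\<close>

theorem theorem4p4:
  shows "((\<exists>x::'a::banach. x \<noteq> 0) \<longrightarrow>
            (\<forall>C\<in>(cbc_sets :: 'a set set). bounded_loose_radius C < \<top>))
       \<and> (\<forall>C\<in>(cbc_sets :: 'a set set). \<forall>D\<in>cbc_sets.
            \<bar>enn2real (bounded_loose_radius C) - enn2real (bounded_loose_radius D)\<bar>
              \<le> hausdorff_dist C D)
       \<and> (separable_space (euclidean :: 'a topology) \<longrightarrow>
            openin (mtopology_of hausdorff_metric) (haar_positive_cbc :: 'a set set)
          \<and> (\<forall>(C :: nat \<Rightarrow> 'a set) L.
               (\<forall>n. C n \<in> cbc_sets \<and> haar_null (C n))
               \<and> limitin (mtopology_of hausdorff_metric) C L sequentially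
               \<longrightarrow> haar_null L))"
proof (intro conjI impI allI ballI)
  fix C :: "'a set" assume "\<exists>x::'a. x \<noteq> 0" "C \<in> cbc_sets"
  then show "bounded_loose_radius C < \<top>"
    using bounded_loose_radius_finite by (auto simp: cbc_sets_def)
next
  fix C D :: "'a set" assume "C \<in> cbc_sets" "D \<in> cbc_sets"
  then show "\<bar>enn2real (bounded_loose_radius C) - enn2real (bounded_loose_radius D)\<bar> \<le> hausdorff_dist C D"
    by (rule bounded_loose_radius_lipschitz)
next
  assume "separable_space (euclidean :: 'a topology)"
  then show "openin (mtopology_of hausdorff_metric) (haar_positive_cbc :: 'a set set)"
    by (rule openin_haar_positive_cbc)
next
  fix C :: "nat \<Rightarrow> 'a set" and L
  assume sep: "separable_space (euclidean :: 'a topology)"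
    and *: "(\<forall>n. C n \<in> cbc_sets \<and> haar_null (C n)) \<and>
      limitin (mtopology_of hausdorff_metric) C L sequentially"
  then have L: "L \<in> cbc_sets"
    using limitin_topspace by (force simp: mspace_hausdorff_metric)
  show "haar_null L"
  proof (rule ccontr)
    assume "\<not> haar_null L"
    with L have "L \<in> haar_positive_cbc"
      by (auto simp: haar_positive_cbc_def haar_positive_def cbc_sets_def)
    with * openin_haar_positive_cbc[OF sep] have "\<forall>\<^sub>F n in sequentially. C n \<in> haar_positive_cbc"
      unfolding limitin_def by blast
    then show False
      using * by (auto simp: eventually_sequentially haar_positive_cbc_def haar_positive_def)
  qed
qed

end
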